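(* Let $m,n\ge 1$ be integers with $\gcd(m,n)\in\{1,2\}$. If the $q$-Fibonomial coefficient $\begin{bmatrix} m+n \\ n \end{bmatrix}_{\mathcal{F}}$ is unimodal, then $[\operatorname{FCat}_{m,n}]_q\in\mathbb{Z}_{\ge 0}[q]$, i.e. $[\operatorname{FCat}_{m,n}]_q$ is a polynomial in $q$ with non-negative integer coefficients.
   Context: $F_n$ denotes the Fibonacci numbers: $F_0=0$, $F_1=1$, $F_n=F_{n-1}+F_{n-2}$ for $n\ge 2$. For a positive integer $n$, $[n]_q := 1+q+\dots+q^{n-1}$, and $[F_n]^!_q := \prod_{k=1}^n [F_k]_q$. The $q$-Fibonomial coefficient is $$\begin{bmatrix} m+n \\ n \end{bmatrix}_{\mathcal{F}} := \frac{[F_{m+n}]^!_q}{[F_m]^!_q\,[F_n]^!_q},$$ known to be a polynomial in $q$ with non-negative integer coefficients. The $q$-FiboCatalan number is $$[\operatorname{FCat}_{m,n}]_q := \frac{1}{[F_{m+n}]_q}\begin{bmatrix} m+n \\ n \end{bmatrix}_{\mathcal{F}} = \frac{[F_{m+n-1}]^!_q}{[F_m]^!_q\,[F_n]^!_q}.$$ It is a known result (Bergeron–Ceballos–Küstner) that $[\operatorname{FCat}_{m,n}]_q\in\mathbb{Z}[q]$ whenever $\gcd(m,n)\in\{1,2\}$. A polynomial $\sum_{k=0}^N c_k q^k$ is unimodal if there is an $M$ with $c_0\le c_1\le\dots\le c_{M-1}\le c_M\ge c_{M+1}\ge\dots\ge c_N$. *)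

theory Defs
  imports
    "HOL-Number_Theory.Fib"
    "HOL-Computational_Algebra.Polynomial_Factorial"
begin

text \<open>
  The quotients below are formed in the fraction field of \<open>\<int>[q]\<close>, so that
  being a polynomial is a genuine assertion about them, namely membership in the image of the
  (injective) embedding \<^const>\<open>to_fract\<close>.
\<close>

definition q_int :: "nat \<Rightarrow> int poly" where
  "q_int n = (\<Sum>i<n. monom 1 i)"

definition q_fib_fact :: "nat \<Rightarrow> int poly" where
  "q_fib_fact n = (\<Prod>k=1..n. q_int (fib k))"

text \<open>\<open>q_fibonomial m n\<close> has upper entry \<open>m + n\<close> and lower entry \<open>n\<close>.\<close>

definition q_fibonomial :: "nat \<Rightarrow> nat \<Rightarrow> int poly fract" where
  "q_fibonomial m n =
     to_fract (q_fib_fact (m + n)) / (to_fract (q_fib_fact m) * to_fract (q_fib_fact n))"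

definition q_fibocatalan :: "nat \<Rightarrow> nat \<Rightarrow> int poly fract" where
  "q_fibocatalan m n = 1 / to_fract (q_int (fib (m + n))) * q_fibonomial m n"

definition unimodal :: "int poly \<Rightarrow> bool" where
  "unimodal p \<longleftrightarrow> (\<exists>M\<le>degree p.
     (\<forall>k<M. coeff p k \<le> coeff p (k + 1)) \<and>
     (\<forall>k. M \<le> k \<and> k < degree p \<longrightarrow> coeff p (k + 1) \<le> coeff p k))"

lemma q_int_eq_0_iff [simp]: "q_int n = 0 \<longleftrightarrow> n = 0"
proof
  assume "q_int n = 0"
  hence "poly (q_int n) 1 = 0" by simp
  thus "n = 0" by (simp add: q_int_def poly_sum poly_monom)
qed (simp add: q_int_def)

lemma q_fibocatalan_altdef:
  assumes "m \<ge> 1" "n \<ge> 1"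
  shows "q_fibocatalan m n =
    to_fract (q_fib_fact (m + n - 1)) / (to_fract (q_fib_fact m) * to_fract (q_fib_fact n))"
proof -
  obtain l where l: "m + n = Suc l" using assms by (cases "m + n") auto
  have "fib (Suc l) \<noteq> 0" using fib_neq_0_nat[of "Suc l"] by simp
  moreover have "q_fib_fact (Suc l) = q_fib_fact l * q_int (fib (Suc l))"
    by (simp add: q_fib_fact_def)
  ultimately show ?thesis
    unfolding q_fibocatalan_def q_fibonomial_def l by simp
qed

end

theory Submission
  imports Defs
begin

text \<open>
  Write \<open>F\<close> for the Fibonacci number with index \<open>m + n\<close>, let \<open>p\<close> be the
  \<open>q\<close>-Fibonomial coefficient and \<open>c\<close> the \<open>q\<close>-FiboCatalan number, so that \<open>p = [F] c\<close>.

  Integrality of \<open>c\<close> (lemma \<open>q_int_dvd_of_fibonomial\<close>) rests on two facts.  All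
  \<open>q\<close>-Fibonomials are polynomials, by a \<open>q\<close>-analogue of Pascal's rule that comes from
  the addition law of the Fibonacci numbers, and \<open>[a]\<close>, \<open>[b]\<close> are coprime in \<open>\<int>[q]\<close>
  whenever \<open>a\<close>, \<open>b\<close> are coprime.  Indeed \<open>[F]\<close> divides \<open>[fib m] p\<close>, with the
  \<open>q\<close>-Fibonomial for \<open>m - 1\<close> and \<open>n\<close> as quotient, and it is coprime to \<open>[fib m]\<close>, because
  \<open>fib m\<close> and \<open>F\<close> have greatest common divisor \<open>fib (gcd m n) = 1\<close>.

  Non-negativity (lemma \<open>quotient_by_q_int_nonneg\<close>) uses \<open>(1 - q\<^sup>F) c = (1 - q) p\<close>, that is
  \<open>c\<^sub>k = c\<^sub>k\<^sub>-\<^sub>F + (p\<^sub>k - p\<^sub>k\<^sub>-\<^sub>1)\<close>.  Being products and quotients of palindromic polynomials,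
  \<open>p\<close> and \<open>c\<close> are palindromic.  A unimodal palindromic polynomial increases up to the middle,
  so the recurrence gives \<open>c\<^sub>k \<ge> 0\<close> for all \<open>k\<close> up to half the degree of \<open>p\<close>.  This covers
  the lower half of \<open>c\<close>, whose degree does not exceed that of \<open>p\<close>, and symmetry gives
  the upper half.
\<close>

section \<open>Arithmetic of \<open>q\<close>-integers\<close>

lemma coeff_q_int: "coeff (q_int n) i = (if i < n then 1 else 0)"
  by (simp add: q_int_def coeff_sum)

lemma degree_q_int: "degree (q_int n) = n - 1"
proof (cases n)
  case (Suc l)
  have "degree (q_int n) \<le> l"
    by (rule degree_le) (auto simp: coeff_q_int Suc)
  moreover have "l \<le> degree (q_int n)"
    by (rule le_degree) (simp add: coeff_q_int Suc)
  ultimately show ?thesis using Suc by simp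
qed (simp add: q_int_def)

lemma q_int_add: "q_int (a + b) = q_int a + monom 1 a * q_int b"
  by (rule poly_eqI) (auto simp: coeff_q_int coeff_monom_mult)

lemma q_int_dvd_q_int_mult: "q_int a dvd q_int (a * b)"
proof (induction b)
  case 0
  show ?case by (simp add: q_int_def)
next
  case (Suc b)
  thus ?case by (simp add: q_int_add)
qed

lemma one_minus_q_mult_q_int: "(1 - monom 1 1) * q_int n = 1 - monom 1 n"
proof -
  have "q_int 1 + monom 1 1 * q_int n = q_int n + monom 1 n * q_int 1"
    using q_int_add[of 1 n] q_int_add[of n 1] by (simp add: add.commute)
  moreover have "q_int 1 = 1" by (simp add: q_int_def)
  ultimately show ?thesis by (simp add: algebra_simps)
qed

text \<open>
  The Euclidean algorithm on the indices: \<open>[b] = [b - a] + q\<^bsup>b - a\<^esup> [a]\<close>, so a common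
  divisor of \<open>[a]\<close> and \<open>[b]\<close> also divides \<open>[b - a]\<close>.
\<close>

lemma common_dvd_q_int_gcd:
  assumes "d dvd q_int a" "d dvd q_int b"
  shows "d dvd q_int (gcd a b)"
  using assms
proof (induction "a + b" arbitrary: a b rule: less_induct)
  case less
  have step: "d dvd q_int (gcd x y)"
    if "x + y = a + b" "0 < x" "x \<le> y" "d dvd q_int x" "d dvd q_int y" for x y
  proof -
    have "q_int y = q_int (y - x) + monom 1 (y - x) * q_int x"
      using q_int_add[of "y - x" x] that by simp
    hence "d dvd q_int (y - x)"
      using that by (metis dvd_add_left_iff dvd_mult)
    hence "d dvd q_int (gcd x (y - x))"
      using less.hyps[of x "y - x"] that by simp
    moreover have "gcd x (y - x) = gcd x y"
      using that by (metis gcd.commute gcd_diff1_nat)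
    ultimately show ?thesis by simp
  qed
  show ?case
  proof (cases "a = 0 \<or> b = 0")
    case True
    thus ?thesis using less.prems by auto
  next
    case False
    thus ?thesis
      using step[of a b] step[of b a] less.prems
      by (cases "a \<le> b") (auto simp: gcd.commute add.commute)
  qed
qed

lemma coprime_q_int:
  assumes "coprime a b"
  shows "coprime (q_int a) (q_int b)"
proof (rule coprimeI)
  fix d assume "d dvd q_int a" "d dvd q_int b"
  hence "d dvd q_int (gcd a b)" by (rule common_dvd_q_int_gcd)
  thus "is_unit d" using assms by (simp add: q_int_def)
qed

section \<open>Integrality\<close>

lemma q_fib_fact_0 [simp]: "q_fib_fact 0 = 1"
  by (simp add: q_fib_fact_def)

lemma q_fib_fact_Suc: "q_fib_fact (Suc n) = q_fib_fact n * q_int (fib (Suc n))"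
  by (simp add: q_fib_fact_def)

lemma q_fib_fact_nonzero [simp]: "q_fib_fact n \<noteq> 0"
  by (induction n) (auto simp: q_fib_fact_Suc fib_neq_0_nat simp del: fib.simps)

text \<open>
  Pascal's rule for \<open>q\<close>-Fibonomials: the addition law splits the top factor into
  two summands, one divisible by \<open>[fib (n + 1)]\<close> and one by a power of \<open>q\<close> times
  \<open>[fib (m + 1)]\<close>, which reduces the claim to the pairs with one index lowered.
\<close>

lemma q_fib_fact_mult_dvd: "q_fib_fact m * q_fib_fact n dvd q_fib_fact (m + n)"
proof (induction m arbitrary: n)
  case 0
  show ?case by simp
next
  case (Suc m)
  note IH_m = Suc.IH
  show ?case
  proof (induction n)
    case 0
    show ?case by simp
  next
    case (Suc n)
    let ?A = "q_int (fib (Suc n) * fib (Suc (Suc m)))"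
    let ?B = "q_int (fib (Suc m) * fib n)"
    let ?shift = "monom 1 (fib (Suc n) * fib (Suc (Suc m))) :: int poly"
    let ?G = "q_fib_fact (Suc m + n)"
    have split: "q_int (fib (Suc (Suc m + n))) = ?A + ?shift * ?B"
      unfolding fib_add[of "Suc m" n] by (simp only: q_int_add mult.commute)
    have "(q_fib_fact (Suc m) * q_fib_fact n) * q_int (fib (Suc n)) dvd ?G * ?A"
      by (intro mult_dvd_mono Suc.IH q_int_dvd_q_int_mult)
    hence 1: "q_fib_fact (Suc m) * q_fib_fact (Suc n) dvd ?G * ?A"
      by (simp only: q_fib_fact_Suc[of n] mult.assoc)
    have "q_fib_fact m * q_fib_fact (Suc n) dvd ?G"
      using IH_m[of "Suc n"] by simp
    hence "(q_fib_fact m * q_fib_fact (Suc n)) * q_int (fib (Suc m)) dvd ?G * (?shift * ?B)"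
      by (intro mult_dvd_mono dvd_mult q_int_dvd_q_int_mult)
    hence 2: "q_fib_fact (Suc m) * q_fib_fact (Suc n) dvd ?G * (?shift * ?B)"
      by (simp only: q_fib_fact_Suc[of m] mult_ac)
    have "q_fib_fact (Suc m + Suc n) = ?G * ?A + ?G * (?shift * ?B)"
      using q_fib_fact_Suc[of "Suc m + n"] split by (simp only: add_Suc_right distrib_left)
    with 1 2 show ?case by simp
  qed
qed

lemma q_int_dvd_of_fibonomial:
  assumes "m \<ge> 1" and "gcd m n \<in> {1, 2}"
    and p: "q_fib_fact (m + n) = p * (q_fib_fact m * q_fib_fact n)"
  shows "q_int (fib (m + n)) dvd p"
proof -
  let ?F = "q_int (fib (m + n))"
  obtain l where l: "m = Suc l" using \<open>m \<ge> 1\<close> by (cases m) auto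
  obtain r where r: "q_fib_fact (l + n) = q_fib_fact l * q_fib_fact n * r"
    using q_fib_fact_mult_dvd[of l n] by (elim dvdE)
  have "p * q_int (fib m) * (q_fib_fact l * q_fib_fact n) = p * (q_fib_fact m * q_fib_fact n)"
    unfolding l q_fib_fact_Suc by (simp only: mult_ac)
  also have "\<dots> = q_fib_fact (m + n)" by (rule p [symmetric])
  also have "\<dots> = q_fib_fact (l + n) * ?F"
    by (simp add: l q_fib_fact_Suc del: fib.simps)
  also have "\<dots> = ?F * r * (q_fib_fact l * q_fib_fact n)"
    by (simp only: r mult_ac)
  finally have "p * q_int (fib m) = ?F * r"
    by simp
  hence "?F dvd p * q_int (fib m)" by simp
  moreover have "coprime (fib (m + n)) (fib m)"
  proof -
    have "gcd (fib (m + n)) (fib m) = fib (gcd m n)"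
      by (simp add: fib_gcd[symmetric] gcd.commute)
    also have "\<dots> = 1"
      using assms(2) by (auto simp: numeral_2_eq_2)
    finally show ?thesis by (simp add: coprime_iff_gcd_eq_1)
  qed
  hence "coprime ?F (q_int (fib m))" by (rule coprime_q_int)
  ultimately show ?thesis by (simp add: coprime_dvd_mult_left_iff)
qed

section \<open>Palindromic polynomials\<close>

text \<open>
  A polynomial with non-zero constant term is palindromic exactly if \<^const>\<open>reflect_poly\<close>
  fixes it; multiplicativity of \<^const>\<open>reflect_poly\<close> passes this on to products and quotients.
\<close>

lemma reflect_q_int: "reflect_poly (q_int n) = q_int n"
  by (rule poly_eqI) (auto simp: coeff_reflect_poly degree_q_int coeff_q_int)

lemma reflect_q_fib_fact: "reflect_poly (q_fib_fact n) = q_fib_fact n"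
  by (simp add: q_fib_fact_def reflect_poly_prod reflect_q_int)

lemma reflect_poly_quotient:
  fixes a b c :: "'a :: idom poly"
  assumes "a = b * c" "b \<noteq> 0" "reflect_poly a = a" "reflect_poly b = b"
  shows "reflect_poly c = c"
proof -
  have "b * reflect_poly c = b * c"
    using assms by (metis reflect_poly_mult)
  thus ?thesis using assms(2) by simp
qed

lemma coeff_symmetric:
  assumes "reflect_poly p = p" "k \<le> degree p"
  shows "coeff p k = coeff p (degree p - k)"
  using coeff_reflect_poly[of p k] assms by simp

lemma coeff_0_q_fib_fact: "coeff (q_fib_fact n) 0 = 1"
  by (induction n)
     (auto simp: q_fib_fact_Suc coeff_mult coeff_q_int fib_neq_0_nat simp del: fib.simps)

section \<open>Non-negativity\<close>

lemma unimodal_decreasing: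
  assumes "\<forall>k. M \<le> k \<and> k < degree p \<longrightarrow> coeff p (k + 1) \<le> coeff p k"
    and "M \<le> i" "i \<le> j" "j \<le> degree p"
  shows "coeff p j \<le> (coeff p i :: int)"
  using assms(3,4)
proof (induction j rule: dec_induct)
  case base
  show ?case by simp
next
  case (step j)
  have "coeff p (Suc j) \<le> coeff p j" using assms(1,2) step by auto
  with step show ?case by simp
qed

text \<open>
  If the peak lies at or before \<open>k\<close>, then the coefficients with indices from \<open>k\<close> to its mirror
  image \<open>degree p - k\<close> decrease, yet the two end values agree; hence they are all equal.
\<close>

lemma unimodal_palindromic_increasing:
  assumes "unimodal p" "reflect_poly p = p" "2 * k < degree p"
  shows "coeff p k \<le> coeff p (Suc k)"
proof -
  from assms(1) obtain M where
    up: "\<forall>k<M. coeff p k \<le> coeff p (k + 1)" and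
    down: "\<forall>k. M \<le> k \<and> k < degree p \<longrightarrow> coeff p (k + 1) \<le> coeff p k"
    unfolding unimodal_def by blast
  show ?thesis
  proof (cases "k < M")
    case True
    thus ?thesis using up by simp
  next
    case False
    have "coeff p k = coeff p (degree p - k)"
      using assms by (intro coeff_symmetric) auto
    also have "\<dots> \<le> coeff p (Suc k)"
      using False assms(3) by (intro unimodal_decreasing[OF down]) auto
    finally show ?thesis .
  qed
qed

lemma quotient_by_q_int_nonneg:
  assumes "unimodal p" and pal: "reflect_poly p = p" "reflect_poly c = c"
    and "coeff p 0 \<ge> 0" and "p = q_int a * c" and "a > 0"
  shows "coeff c k \<ge> 0"
proof (cases "c = 0")
  case False
  have deg: "degree c \<le> degree p"
    using assms False by (simp add: degree_mult_eq)
  have "(1 - monom 1 1) * p = (1 - monom 1 a) * c"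
    unfolding \<open>p = q_int a * c\<close> one_minus_q_mult_q_int[of a, symmetric] by (simp only: mult.assoc)
  hence "p - monom 1 1 * p = c - monom 1 a * c"
    by (simp only: left_diff_distrib mult_1_left)
  hence "coeff p i - coeff (monom 1 1 * p) i = coeff c i - coeff (monom 1 a * c) i" for i
    by (metis coeff_diff)
  \<comment> \<open>Natural number subtraction is truncated, hence the explicit case distinctions.\<close>
  hence rec: "coeff c i = (if i < a then 0 else coeff c (i - a)) +
      (coeff p i - (if i = 0 then 0 else coeff p (i - 1)))" for i
    unfolding coeff_monom_mult by (smt (verit) One_nat_def less_one mult_1 not_less)
  have lower: "coeff c i \<ge> 0" if "2 * i \<le> degree p" for i
    using that
  proof (induction i rule: less_induct)
    case (less i)
    have "coeff p i - (if i = 0 then 0 else coeff p (i - 1)) \<ge> 0"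
    proof (cases i)
      case 0
      thus ?thesis using assms(4) by simp
    next
      case (Suc j)
      thus ?thesis
        using unimodal_palindromic_increasing[OF assms(1) pal(1), of j] less.prems by simp
    qed
    moreover have "(if i < a then 0 else coeff c (i - a)) \<ge> 0"
      using less.IH[of "i - a"] less.prems \<open>a > 0\<close> by auto
    ultimately show ?case by (subst rec) (rule add_nonneg_nonneg)
  qed
  consider "2 * k \<le> degree c" | "degree c < 2 * k" "k \<le> degree c" | "degree c < k"
    by linarith
  thus ?thesis
  proof cases
    case 1
    thus ?thesis using lower[of k] deg by simp
  next
    case 2
    hence "coeff c k = coeff c (degree c - k)" by (intro coeff_symmetric pal)
    thus ?thesis using lower[of "degree c - k"] deg 2 by simp
  next
    case 3
    thus ?thesis by (simp add: coeff_eq_0)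
  qed
qed simp

theorem proposition5p6:
  fixes m n :: nat
  assumes "m \<ge> 1" and "n \<ge> 1"
    and "gcd m n \<in> {1, 2}"
    and "\<exists>p :: int poly. q_fibonomial m n = to_fract p \<and> unimodal p"
  shows "\<exists>p :: int poly. q_fibocatalan m n = to_fract p \<and> (\<forall>k. coeff p k \<ge> 0)"
proof -
  let ?a = "fib (m + n)"
  from assms(4) obtain p where p: "q_fibonomial m n = to_fract p" and uni: "unimodal p"
    by blast
  have a: "?a > 0" using assms(1) by (intro fib_neq_0_nat) simp
  have "to_fract (q_fib_fact (m + n)) = to_fract (p * (q_fib_fact m * q_fib_fact n))"
    using p by (simp add: q_fibonomial_def divide_eq_eq)
  hence fact: "q_fib_fact (m + n) = (q_fib_fact m * q_fib_fact n) * p"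
    by (simp only: to_fract_eq_iff mult.commute)
  hence "q_int ?a dvd p"
    using assms by (intro q_int_dvd_of_fibonomial) (simp_all only: mult.commute)
  then obtain c where c: "p = q_int ?a * c" by (elim dvdE)
  have pal_p: "reflect_poly p = p"
    using reflect_poly_quotient[OF fact]
    by (simp add: reflect_q_fib_fact reflect_poly_mult)
  have pal_c: "reflect_poly c = c"
    using reflect_poly_quotient[OF c] pal_p a by (simp add: reflect_q_int)
  have "coeff p 0 = 1"
    using arg_cong[OF fact, of "\<lambda>r. coeff r 0"]
    by (simp add: coeff_mult coeff_0_q_fib_fact)
  hence "\<forall>k. coeff c k \<ge> 0"
    using quotient_by_q_int_nonneg[OF uni pal_p pal_c _ c a] by simp
  moreover have "q_fibocatalan m n = to_fract c"
    using a by (simp add: q_fibocatalan_def p c)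
  ultimately show ?thesis by blast
qed

end
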